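(* Let $\mathrm{op}$ be any one of the following operations on permutations: block reversal, block transposition, block interchange, prefix transposition, prefix reversal, cut-paste. For every positive integer $k$, the set of all permutations (of all lengths) that can be transformed into the identity permutation of the same length by at most $k$ applications of $\mathrm{op}$ is a polynomial class.
   Context: A block of $\pi=\pi_1\cdots\pi_n$ is a contiguous string $\pi_i\pi_{i+1}\cdots\pi_{i+m}$; a prefix is a block starting at $\pi_1$. Block reversal: reverse the entries of a block. Block transposition: move a block to another location in the sequence. Block interchange: swap the positions of two non-intersecting blocks. Prefix transposition: move a prefix to another location. Prefix reversal: reverse a prefix. Cut-paste: move a block to another location, optionally reversing it. A permutation class is a set of permutations closed under taking patterns ($\sigma$ is a pattern of $\pi$ if some subsequence of $\pi$ has the same relative order as $\sigma$). A permutation class $\mathcal{C}$ is a polynomial class if the number of permutations of length $n$ in $\mathcal{C}$ is given by a polynomial in $n$ for all sufficiently large $n$. *)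

theory Defs
  imports
    "HOL-Library.Sublist"
    "HOL-Combinatorics.Multiset_Permutations"
    "HOL-Computational_Algebra.Polynomial"
begin

text \<open>
  A permutation of length \<open>n\<close> is given in one-line notation, as a list enumerating \<open>{1..n}\<close>
  without repetition. The empty permutation is admitted.
\<close>

definition is_perm :: "nat list \<Rightarrow> bool" where
  "is_perm \<pi> \<longleftrightarrow> \<pi> \<in> permutations_of_set {1..length \<pi>}"

definition id_perm :: "nat \<Rightarrow> nat list" where
  "id_perm n = [1..<Suc n]"

definition order_isomorphic :: "nat list \<Rightarrow> nat list \<Rightarrow> bool" where
  "order_isomorphic xs ys \<longleftrightarrow>
     length xs = length ys \<and>
     (\<forall>i<length xs. \<forall>j<length xs. xs ! i < xs ! j \<longleftrightarrow> ys ! i < ys ! j)"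

definition is_pattern_of :: "nat list \<Rightarrow> nat list \<Rightarrow> bool" where
  "is_pattern_of \<sigma> \<pi> \<longleftrightarrow> (\<exists>xs. subseq xs \<pi> \<and> order_isomorphic \<sigma> xs)"

definition permutation_class :: "nat list set \<Rightarrow> bool" where
  "permutation_class C \<longleftrightarrow>
     (\<forall>\<pi>\<in>C. is_perm \<pi>) \<and>
     (\<forall>\<pi>\<in>C. \<forall>\<sigma>. is_perm \<sigma> \<and> is_pattern_of \<sigma> \<pi> \<longrightarrow> \<sigma> \<in> C)"

definition polynomial_class :: "nat list set \<Rightarrow> bool" where
  "polynomial_class C \<longleftrightarrow>
     permutation_class C \<and>
     (\<exists>(p :: real poly) N. \<forall>n\<ge>N. real (card {\<pi>\<in>C. length \<pi> = n}) = poly p (real n))"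

text \<open>
  In the relations below the first argument is the sequence before and the second the sequence
  after one application. Blocks are nonempty. Moving a block \<open>b\<close> means deleting it from
  \<open>a @ b @ c\<close> and reinserting it in the remaining sequence \<open>a @ c = u @ v\<close> between \<open>u\<close> and \<open>v\<close>;
  the location is another one precisely when \<open>u \<noteq> a\<close>.
\<close>

definition block_reversal :: "'a list \<Rightarrow> 'a list \<Rightarrow> bool" where
  "block_reversal xs ys \<longleftrightarrow>
     (\<exists>a b c. b \<noteq> [] \<and> xs = a @ b @ c \<and> ys = a @ rev b @ c)"

definition block_transposition :: "'a list \<Rightarrow> 'a list \<Rightarrow> bool" where
  "block_transposition xs ys \<longleftrightarrow>
     (\<exists>a b c u v. b \<noteq> [] \<and> xs = a @ b @ c \<and> a @ c = u @ v \<and> u \<noteq> a \<and> ys = u @ b @ v)"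

definition block_interchange :: "'a list \<Rightarrow> 'a list \<Rightarrow> bool" where
  "block_interchange xs ys \<longleftrightarrow>
     (\<exists>a b c d e. b \<noteq> [] \<and> d \<noteq> [] \<and>
        xs = a @ b @ c @ d @ e \<and> ys = a @ d @ c @ b @ e)"

definition prefix_transposition :: "'a list \<Rightarrow> 'a list \<Rightarrow> bool" where
  "prefix_transposition xs ys \<longleftrightarrow>
     (\<exists>b c u v. b \<noteq> [] \<and> xs = b @ c \<and> c = u @ v \<and> u \<noteq> [] \<and> ys = u @ b @ v)"

definition prefix_reversal :: "'a list \<Rightarrow> 'a list \<Rightarrow> bool" where
  "prefix_reversal xs ys \<longleftrightarrow>
     (\<exists>b c. b \<noteq> [] \<and> xs = b @ c \<and> ys = rev b @ c)"

text \<open>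
  Requiring another location does not exclude reversals in place: reversing \<open>b @ [x]\<close> in place
  with \<open>b\<close> nonempty is the same as moving \<open>b\<close>, reversed, to the right of \<open>x\<close>.
\<close>

definition cut_paste :: "'a list \<Rightarrow> 'a list \<Rightarrow> bool" where
  "cut_paste xs ys \<longleftrightarrow>
     (\<exists>a b c u v. b \<noteq> [] \<and> xs = a @ b @ c \<and> a @ c = u @ v \<and> u \<noteq> a \<and>
        (ys = u @ b @ v \<or> ys = u @ rev b @ v))"

datatype perm_op =
    Block_Reversal
  | Block_Transposition
  | Block_Interchange
  | Prefix_Transposition
  | Prefix_Reversal
  | Cut_Paste

fun op_step :: "perm_op \<Rightarrow> nat list \<Rightarrow> nat list \<Rightarrow> bool" where
  "op_step Block_Reversal = block_reversal"
| "op_step Block_Transposition = block_transposition"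
| "op_step Block_Interchange = block_interchange"
| "op_step Prefix_Transposition = prefix_transposition"
| "op_step Prefix_Reversal = prefix_reversal"
| "op_step Cut_Paste = cut_paste"

definition sortable_within :: "perm_op \<Rightarrow> nat \<Rightarrow> nat list set" where
  "sortable_within f k =
     {\<pi>. is_perm \<pi> \<and> (\<exists>j\<le>k. (op_step f ^^ j) \<pi> (id_perm (length \<pi>)))}"

end

theory Submission
  imports Defs
begin

text \<open>
  Cut a permutation into its strips, the maximal runs of entries in which neighbours differ by one.
  A permutation is determined by its type (the relative order of the strips and the kind of each:
  singleton, increasing or decreasing) together with the vector of excess strip lengths, measured
  above 1 for a singleton and above 2 for a proper run. An operation creates at most four new
  strip boundaries, so only finitely many types occur among the permutations sortable within
  \<open>k\<close> steps. Deleting an inner entry of a strip decrements one component of the vector and keeps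
  the type; as the sortable permutations are closed under patterns, the vectors that belong to a
  fixed type form a down-set of \<open>\<nat>\<^sup>d\<close>. By Dickson's lemma the slices of a down-set along
  its first coordinate stabilise, and induction on \<open>d\<close> shows that the number of its elements
  with coordinate sum \<open>n\<close> is eventually a polynomial in \<open>n\<close>.
\<close>

section \<open>Eventually polynomial functions\<close>

definition eventually_poly :: "(nat \<Rightarrow> real) \<Rightarrow> bool" where
  "eventually_poly f \<longleftrightarrow> (\<exists>p N. \<forall>n\<ge>N. f n = poly p (real n))"

lemma eventually_poly_cong:
  assumes "eventually_poly f" "\<And>n. n \<ge> N \<Longrightarrow> g n = f n"
  shows "eventually_poly g"
proof -
  obtain p M where "\<forall>n\<ge>M. f n = poly p (real n)"
    using assms(1) by (auto simp: eventually_poly_def)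
  then have "\<forall>n\<ge>max M N. g n = poly p (real n)"
    using assms(2) by auto
  then show ?thesis
    unfolding eventually_poly_def by blast
qed

lemma eventually_poly_const: "eventually_poly (\<lambda>_. c)"
  unfolding eventually_poly_def by (rule exI[of _ "[:c:]"]) auto

lemma eventually_poly_add:
  assumes "eventually_poly f" "eventually_poly g"
  shows "eventually_poly (\<lambda>n. f n + g n)"
proof -
  obtain p M q N where "\<forall>n\<ge>M. f n = poly p (real n)" "\<forall>n\<ge>N. g n = poly q (real n)"
    using assms by (auto simp: eventually_poly_def)
  then have "\<forall>n\<ge>max M N. f n + g n = poly (p + q) (real n)"
    by auto
  then show ?thesis
    unfolding eventually_poly_def by blast
qed

lemma eventually_poly_sum:
  assumes "\<And>i. i \<in> I \<Longrightarrow> eventually_poly (f i)"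
  shows "eventually_poly (\<lambda>n. \<Sum>i\<in>I. f i n)"
  using assms
  by (induction I rule: infinite_finite_induct) (auto intro: eventually_poly_const eventually_poly_add)

text \<open>Truncated subtraction does no harm: for \<open>n \<ge> N + c\<close> the value at
  \<open>n - c\<close> is that of the polynomial composed with the real shift by
  \<open>c\<close>.\<close>

lemma eventually_poly_shift:
  assumes "eventually_poly f"
  shows "eventually_poly (\<lambda>n. f (n - c))"
proof -
  obtain p N where p: "\<forall>n\<ge>N. f n = poly p (real n)"
    using assms by (auto simp: eventually_poly_def)
  have "f (n - c) = poly (pcompose p [:- real c, 1:]) (real n)" if "n \<ge> N + c" for n
    using that p by (simp add: poly_pcompose of_nat_diff)
  then show ?thesis
    unfolding eventually_poly_def by blast
qed

text \<open>By the binomial theorem the difference of \<open>x ^ Suc k\<close> is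
  \<open>Suc k\<close> times \<open>x ^ k\<close> plus lower powers. Strong induction supplies
  antidifferences of the lower powers; subtract them and rescale.\<close>

lemma antidifference_monom:
  "\<exists>q::real poly. \<forall>x. poly q (x + 1) - poly q x = x ^ k"
proof (induction k rule: less_induct)
  case (less k)
  then have "\<forall>i. \<exists>q::real poly. i < k \<longrightarrow> (\<forall>x. poly q (x + 1) - poly q x = x ^ i)"
    by blast
  then obtain Q where Q: "\<And>i x. i < k \<Longrightarrow> poly (Q i) (x + 1) - poly (Q i) x = (x::real) ^ i"
    by metis
  define q where
    "q = smult (1 / real (k + 1)) (monom 1 (Suc k) - (\<Sum>i<k. smult (real (Suc k choose i)) (Q i)))"
  have "poly q (x + 1) - poly q x = x ^ k" for x
  proof -
    have "(x + 1) ^ Suc k = (\<Sum>i\<le>Suc k. real (Suc k choose i) * x ^ i)"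
      using binomial_ring[of x 1 "Suc k"] by simp
    also have "\<dots> = (\<Sum>i<k. real (Suc k choose i) * x ^ i) + real (Suc k) * x ^ k + x ^ Suc k"
      by (simp only: lessThan_Suc_atMost[symmetric] sum.lessThan_Suc) simp
    finally have A: "(x + 1) ^ Suc k - x ^ Suc k
        = (\<Sum>i<k. real (Suc k choose i) * x ^ i) + real (Suc k) * x ^ k"
      by simp
    have "poly q (x + 1) - poly q x = (1 / real (k + 1)) * ((x + 1) ^ Suc k - x ^ Suc k
        - (\<Sum>i<k. real (Suc k choose i) * (poly (Q i) (x + 1) - poly (Q i) x)))"
      by (simp add: q_def poly_monom poly_sum sum_subtractf right_diff_distrib del: power_Suc)
    also have "\<dots> = (1 / real (k + 1)) * (real (Suc k) * x ^ k)"
      by (subst A) (simp add: Q)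
    finally show ?thesis
      by simp
  qed
  then show ?case
    by blast
qed

lemma antidifference_poly:
  "\<exists>q::real poly. \<forall>x. poly q (x + 1) - poly q x = poly p x"
proof -
  obtain Q where Q: "\<And>k x. poly (Q k) (x + 1) - poly (Q k) x = (x::real) ^ k"
    using antidifference_monom by metis
  let ?q = "\<Sum>i\<le>degree p. smult (coeff p i) (Q i)"
  have "poly ?q (x + 1) - poly ?q x = poly p x" for x
    by (simp add: poly_sum poly_altdef[of p] sum_subtractf[symmetric] right_diff_distrib[symmetric] Q)
  then show ?thesis
    by blast
qed

text \<open>From \<open>N\<close> on the sum telescopes along an antidifference of the polynomial;
  the constant \<open>c\<close> absorbs the irregular initial values.\<close>

lemma eventually_poly_partial_sums:
  assumes "eventually_poly f"
  shows "eventually_poly (\<lambda>n. \<Sum>m\<le>n. f m)"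
proof -
  obtain p N where p: "\<forall>n\<ge>N. f n = poly p (real n)"
    using assms by (auto simp: eventually_poly_def)
  obtain q where q: "\<And>x. poly q (x + 1) - poly q x = poly p x"
    using antidifference_poly by blast
  define c where "c = (\<Sum>m<N. f m) - poly q (real N)"
  have lt: "(\<Sum>m<n. f m) = poly q (real n) + c" if "n \<ge> N" for n
    using that
  proof (induction n rule: dec_induct)
    case base
    then show ?case by (simp add: c_def)
  next
    case (step n)
    then show ?case
      using p q[of "real n"] by (simp add: algebra_simps)
  qed
  \<comment> \<open>The sum includes the index \<open>n\<close>, so the formula is taken at
    \<open>Suc n\<close>; composing with \<open>[:1, 1:]\<close> performs this shift.\<close>
  have "(\<Sum>m\<le>n. f m) = poly (pcompose q [:1, 1:] + [:c:]) (real n)" if "n \<ge> N" for n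
    using lt[of "Suc n"] that by (simp add: poly_pcompose lessThan_Suc_atMost add.commute)
  then show ?thesis
    unfolding eventually_poly_def by blast
qed

section \<open>Down-sets of vectors\<close>

text \<open>\<open>list_all2\<close> relates only lists of equal length, so vectors of different
  dimensions never interact.\<close>

definition down_closed :: "nat list set \<Rightarrow> bool" where
  "down_closed D \<longleftrightarrow> (\<forall>v\<in>D. \<forall>u. list_all2 (\<le>) u v \<longrightarrow> u \<in> D)"

text \<open>Dickson's lemma in subsequence form: the induction hypothesis orders the tails along a
  subsequence, and a further monotone subsequence of the heads takes care of the first
  coordinate.\<close>

lemma dickson_subsequence:
  fixes v :: "nat \<Rightarrow> nat list"
  assumes "\<And>i. length (v i) = d"
  shows "\<exists>r :: nat \<Rightarrow> nat. strict_mono r \<and> (\<forall>i j. i \<le> j \<longrightarrow> list_all2 (\<le>) (v (r i)) (v (r j)))"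
  using assms
proof (induction d arbitrary: v)
  case 0
  then show ?case
    by (intro exI[of _ "\<lambda>i. i"]) (auto simp: strict_mono_def)
next
  case (Suc d)
  have "length (tl (v i)) = d" for i
    using Suc.prems[of i] by simp
  then obtain r :: "nat \<Rightarrow> nat" where r: "strict_mono r"
    "\<And>i j. i \<le> j \<Longrightarrow> list_all2 (\<le>) (tl (v (r i))) (tl (v (r j)))"
    using Suc.IH[of "\<lambda>i. tl (v i)"] by auto
  obtain s where s: "strict_mono s" "monoseq (\<lambda>n. hd (v (r (s n))))"
    using seq_monosub[of "\<lambda>n. hd (v (r n))"] by auto
  define h where "h n = hd (v (r (s n)))" for n
  \<comment> \<open>A nonincreasing sequence of naturals is constant once it attains its minimum, so
    in either case the heads are eventually nondecreasing.\<close>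
  have "\<exists>N. \<forall>i j. N \<le> i \<longrightarrow> i \<le> j \<longrightarrow> h i \<le> h j"
  proof (cases "\<forall>m n. m \<le> n \<longrightarrow> h m \<le> h n")
    case False
    then have dec: "h n \<le> h m" if "m \<le> n" for m n
      using s(2) that unfolding monoseq_def h_def by blast
    obtain N where N: "h N = (LEAST y. y \<in> range h)"
      using LeastI[of "\<lambda>y. y \<in> range h" "h 0"] by auto
    have "h N \<le> h j" for j
      unfolding N by (rule Least_le) simp
    then have "h i \<le> h j" if "N \<le> i" for i j
      using dec[OF that] order_trans by blast
    then show ?thesis by blast
  qed blast
  then obtain N where N: "\<And>i j. N \<le> i \<Longrightarrow> i \<le> j \<Longrightarrow> h i \<le> h j"
    by blast
  define t where "t i = r (s (N + i))" for i
  have "strict_mono t"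
    using r(1) s(1) unfolding t_def strict_mono_def by auto
  moreover have "list_all2 (\<le>) (v (t i)) (v (t j))" if "i \<le> j" for i j
  proof -
    have "s (N + i) \<le> s (N + j)"
      using s(1) that by (simp add: strict_mono_less_eq)
    then have "list_all2 (\<le>) (tl (v (t i))) (tl (v (t j)))"
      unfolding t_def by (rule r(2))
    moreover have "hd (v (t i)) \<le> hd (v (t j))"
      using N[of "N + i" "N + j"] that by (simp add: h_def t_def)
    moreover have "v (t i) \<noteq> []" "v (t j) \<noteq> []"
      using Suc.prems by (metis length_0_conv nat.distinct(1))+
    ultimately show ?thesis
      by (cases "v (t i)"; cases "v (t j)") auto
  qed
  ultimately show ?case
    by blast
qed

text \<open>Otherwise infinitely many members drop out of the chain one after another. By Dickson's
  lemma an earlier lost vector lies below a later one that is still present, and down-closure brings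
  the lost vector back.\<close>

lemma down_closed_chain_stabilises:
  fixes D :: "nat \<Rightarrow> nat list set"
  assumes dc: "\<And>j. down_closed (D j)"
    and len: "\<And>j v. v \<in> D j \<Longrightarrow> length v = d"
    and dec: "\<And>j. D (Suc j) \<subseteq> D j"
  shows "\<exists>J. \<forall>j\<ge>J. D j = D J"
proof (rule ccontr)
  have anti: "D j \<subseteq> D i" if "i \<le> j" for i j
    using that dec by (induction j rule: dec_induct) auto
  assume "\<not> ?thesis"
  then have "\<forall>J. \<exists>j v. j > J \<and> v \<in> D J \<and> v \<notin> D j"
    using anti by (metis le_neq_implies_less subsetI subset_antisym)
  then obtain nxt w where nw: "\<And>J. nxt J > J" "\<And>J. w J \<in> D J" "\<And>J. w J \<notin> D (nxt J)"
    by metis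
  \<comment> \<open>Iterating \<open>nxt\<close> gives stages such that \<open>w (x i)\<close>
    belongs to stage \<open>x i\<close> but has been lost at stage \<open>x (Suc i)\<close>.\<close>
  define x where "x = rec_nat 0 (\<lambda>_. nxt)"
  have x: "x (Suc i) = nxt (x i)" for i
    by (simp add: x_def)
  have xm: "strict_mono x"
    by (simp add: strict_mono_Suc_iff x nw)
  obtain r :: "nat \<Rightarrow> nat" where r: "strict_mono r" "\<And>i j. i \<le> j \<Longrightarrow> list_all2 (\<le>) (w (x (r i))) (w (x (r j)))"
    using dickson_subsequence[of "\<lambda>i. w (x i)" d] len[OF nw(2)] by auto
  have "Suc (r 0) \<le> r 1"
    using r(1) by (simp add: strict_mono_def Suc_le_eq)
  then have "nxt (x (r 0)) \<le> x (r 1)"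
    using xm by (metis x strict_mono_less_eq)
  then have "w (x (r 1)) \<in> D (nxt (x (r 0)))"
    using anti nw(2) by blast
  then have "w (x (r 0)) \<in> D (nxt (x (r 0)))"
    using dc r(2)[of 0 1] unfolding down_closed_def by auto
  then show False
    using nw(3) by blast
qed

lemma finite_sum_list_eq: "finite {v :: nat list. length v = d \<and> sum_list v = n}"
proof (rule finite_subset)
  show "{v. length v = d \<and> sum_list v = n} \<subseteq> {v. set v \<subseteq> {..n} \<and> length v = d}"
    using member_le_sum_list by fastforce
  show "finite {v::nat list. set v \<subseteq> {..n} \<and> length v = d}"
    by (rule finite_lists_length_eq) simp
qed

text \<open>Slice by the first coordinate. The slices decrease, hence are constant from some
  \<open>J\<close> on: finitely many slices contribute shifted counts, and the constant tail
  contributes partial sums of one count.\<close>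

lemma eventually_poly_down_closed:
  assumes "down_closed D" "\<And>v. v \<in> D \<Longrightarrow> length v = d"
  shows "eventually_poly (\<lambda>n. real (card {v\<in>D. sum_list v = n}))"
  using assms
proof (induction d arbitrary: D)
  case 0
  \<comment> \<open>In dimension 0 only the empty vector can occur, and its sum is 0.\<close>
  have "{v \<in> D. sum_list v = n} = {}" if "n \<ge> 1" for n
    using 0(2) that by fastforce
  then show ?case
    by (intro eventually_poly_cong[OF eventually_poly_const[of 0], of 1]) (simp only: card.empty of_nat_0)
next
  case (Suc d)
  define E where "E j = {w. j # w \<in> D}" for j
  define c where "c j n = real (card {w \<in> E j. sum_list w = n})" for j n
  have dcE: "down_closed (E j)" for j
    using Suc.prems(1) unfolding E_def down_closed_def by auto
  have lenE: "length w = d" if "w \<in> E j" for w j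
    using Suc.prems(2) that by (fastforce simp: E_def)
  have decE: "E (Suc j) \<subseteq> E j" for j
  proof
    fix w
    assume "w \<in> E (Suc j)"
    moreover have "list_all2 (\<le>) (j # w) (Suc j # w)"
      by (simp add: list_all2_refl)
    ultimately show "w \<in> E j"
      using Suc.prems(1) unfolding E_def down_closed_def by blast
  qed
  obtain J where J: "\<And>j. j \<ge> J \<Longrightarrow> E j = E J"
    using down_closed_chain_stabilises[of E d] dcE lenE decE by metis
  have fin: "finite {w \<in> E j. sum_list w = n}" for j n
    by (rule finite_subset[OF _ finite_sum_list_eq[of d n]]) (auto simp: lenE)
  have slice: "real (card {v \<in> D. sum_list v = n}) = (\<Sum>j\<le>n. c j (n - j))" for n
  proof -
    have "{v \<in> D. sum_list v = n} = (\<Union>j\<le>n. (#) j ` {w \<in> E j. sum_list w = n - j})" (is "?L = ?R")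
    proof
      show "?L \<subseteq> ?R"
      proof
        fix v
        assume v: "v \<in> ?L"
        then obtain j w where "v = j # w"
          using Suc.prems(2) by (metis (lifting) length_Suc_conv mem_Collect_eq)
        then show "v \<in> ?R"
          using v by (intro UN_I[of j]) (auto simp: E_def)
      qed
      show "?R \<subseteq> ?L"
        by (auto simp: E_def)
    qed
    also have "card \<dots> = (\<Sum>j\<le>n. card ((#) j ` {w \<in> E j. sum_list w = n - j}))"
      by (rule card_UN_disjoint) (auto simp: fin)
    also have "\<dots> = (\<Sum>j\<le>n. card {w \<in> E j. sum_list w = n - j})"
      by (intro sum.cong refl card_image) (auto simp: inj_on_def)
    finally show ?thesis
      by (simp add: c_def)
  qed
  have c: "eventually_poly (c j)" for j
    unfolding c_def using Suc.IH[OF dcE lenE] .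
  have "eventually_poly (\<lambda>n. (\<Sum>j<J. c j (n - j)) + (\<Sum>m\<le>n - J. c J m))"
    by (intro eventually_poly_add eventually_poly_sum eventually_poly_shift c
        eventually_poly_shift[OF eventually_poly_partial_sums[OF c]])
  moreover have "real (card {v \<in> D. sum_list v = n}) = (\<Sum>j<J. c j (n - j)) + (\<Sum>m\<le>n - J. c J m)"
    if "n \<ge> J" for n
  proof -
    have "{..n} = {..<J} \<union> {J..n}"
      using that by auto
    then have "(\<Sum>j\<le>n. c j (n - j)) = (\<Sum>j<J. c j (n - j)) + (\<Sum>j\<in>{J..n}. c j (n - j))"
      by (simp add: sum.union_disjoint ivl_disj_int)
    also have "(\<Sum>j\<in>{J..n}. c j (n - j)) = (\<Sum>j\<in>{J..n}. c J (n - j))"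
      by (intro sum.cong refl) (unfold c_def, metis J atLeastAtMost_iff)
    also have "\<dots> = (\<Sum>m\<le>n - J. c J m)"
      by (rule sum.reindex_bij_witness[of _ "\<lambda>m. n - m" "\<lambda>j. n - j"]) (use that in auto)
    finally show ?thesis
      using slice by simp
  qed
  ultimately show ?case
    by (rule eventually_poly_cong)
qed

text \<open>One can descend from a vector to any smaller one by lowering one coordinate by 1 at a
  time; the coordinate sum drives the induction.\<close>

lemma down_closed_if_decrement:
  assumes "\<And>v i. v \<in> D \<Longrightarrow> i < length v \<Longrightarrow> v ! i > 0 \<Longrightarrow> v[i := v ! i - 1] \<in> D"
  shows "down_closed D"
  unfolding down_closed_def
proof (intro ballI allI impI)
  fix u v
  assume "v \<in> D" "list_all2 (\<le>) u v"
  then show "u \<in> D"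
  proof (induction "sum_list v" arbitrary: v rule: less_induct)
    case less
    show ?case
    proof (cases "u = v")
      case False
      have len: "length u = length v" and le: "\<And>i. i < length v \<Longrightarrow> u ! i \<le> v ! i"
        using less.prems by (auto simp: list_all2_conv_all_nth)
      obtain i where i: "i < length v" "u ! i < v ! i"
        using False len le by (metis nat_less_le nth_equalityI)
      have "sum_list (v[i := v ! i - 1]) < sum_list v"
        using i elem_le_sum_list[of i v] by (simp add: sum_list_update)
      moreover have "list_all2 (\<le>) u (v[i := v ! i - 1])"
        using len le i by (auto simp: list_all2_conv_all_nth nth_list_update)
      ultimately show ?thesis
        using less.hyps assms[OF less.prems(1) i(1)] i(2) by auto
    qed (use less in simp)
  qed
qed

section \<open>Strips\<close>

definition adj :: "nat \<Rightarrow> nat \<Rightarrow> bool" where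
  "adj x y \<longleftrightarrow> x = Suc y \<or> y = Suc x"

lemma adj_commute: "adj x y \<longleftrightarrow> adj y x"
  by (auto simp: adj_def)

fun strips :: "nat list \<Rightarrow> nat list list" where
  "strips [] = []"
| "strips [x] = [[x]]"
| "strips (x # y # zs) =
     (if adj x y then (x # hd (strips (y # zs))) # tl (strips (y # zs)) else [x] # strips (y # zs))"

definition strip_decomp :: "nat list list \<Rightarrow> bool" where
  "strip_decomp bs \<longleftrightarrow> [] \<notin> set bs \<and> (\<forall>b\<in>set bs. successively adj b)
     \<and> successively (\<lambda>b c. \<not> adj (last b) (hd c)) bs"

lemma strips_eq_Nil_iff [simp]: "strips xs = [] \<longleftrightarrow> xs = []"
  by (induction xs rule: strips.induct) auto

lemma strip_decomp_Nil [simp]: "strip_decomp []"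
  by (simp add: strip_decomp_def)

lemma strip_decomp_Cons:
  "strip_decomp (b # bs) \<longleftrightarrow> b \<noteq> [] \<and> successively adj b \<and> strip_decomp bs \<and>
     (bs \<noteq> [] \<longrightarrow> \<not> adj (last b) (hd (hd bs)))"
  by (auto simp: strip_decomp_def successively_Cons)

lemma concat_strips [simp]: "concat (strips xs) = xs"
  and strip_decomp_strips: "strip_decomp (strips xs)"
proof -
  have "concat (strips xs) = xs \<and> (xs \<noteq> [] \<longrightarrow> hd (hd (strips xs)) = hd xs) \<and> strip_decomp (strips xs)"
  proof (induction xs rule: strips.induct)
    case (3 x y zs)
    obtain b bs where b: "strips (y # zs) = b # bs"
      by (cases "strips (y # zs)") auto
    have "b \<noteq> []" "hd b = y"
      using 3 b by (auto simp: strip_decomp_Cons split: if_splits)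
    then show ?case
      using 3 b by (auto simp: strip_decomp_Cons successively_Cons split: if_splits)
  qed (auto simp: strip_decomp_Cons)
  then show "concat (strips xs) = xs" "strip_decomp (strips xs)"
    by auto
qed

lemma strips_run_append:
  assumes "b \<noteq> []" "successively adj b" "ys \<noteq> [] \<Longrightarrow> \<not> adj (last b) (hd ys)"
  shows "strips (b @ ys) = b # strips ys"
  using assms
proof (induction b rule: strips.induct)
  case (2 x)
  then show ?case by (cases ys) auto
qed auto

text \<open>Uniqueness of the decomposition: to identify the strips of a list it is enough to
  exhibit blocks satisfying \<open>strip_decomp\<close>. This is how the strips after a deletion are
  found.\<close>

lemma strips_concat:
  assumes "strip_decomp bs"
  shows "strips (concat bs) = bs"
  using assms
proof (induction bs)
  case (Cons b bs)
  have "hd (concat bs) = hd (hd bs)" if "bs \<noteq> []"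
    using that Cons.prems by (cases bs) (auto simp: strip_decomp_Cons)
  moreover have "bs \<noteq> []" if "concat bs \<noteq> []"
    using that by auto
  ultimately show ?case
    using Cons strips_run_append[of b "concat bs"] by (metis concat.simps(2) strip_decomp_Cons)
qed simp

section \<open>Type and excess vector of a permutation\<close>

definition strip_kind :: "nat list \<Rightarrow> nat" where
  "strip_kind b = (if length b \<le> 1 then 0 else if b ! 0 < b ! 1 then 1 else 2)"

text \<open>Replaces each entry by its rank among the values, counted from 1, so that permutations
  are fixed points.\<close>

definition standardize :: "nat list \<Rightarrow> nat list" where
  "standardize xs = map (\<lambda>x. card {y \<in> set xs. y \<le> x}) xs"

definition strip_type :: "nat list \<Rightarrow> nat list \<times> nat list" where
  "strip_type xs = (standardize (map hd (strips xs)), map strip_kind (strips xs))"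

text \<open>Truncated subtraction sends lengths 1 and 2 both to 0; \<open>strip_kind\<close> tells
  these two cases apart.\<close>

definition strip_vec :: "nat list \<Rightarrow> nat list" where
  "strip_vec xs = map (\<lambda>b. length b - 2) (strips xs)"

section \<open>Ranks and standardization\<close>

lemma card_le_less_iff:
  assumes "finite (A :: nat set)" "x \<in> A" "y \<in> A"
  shows "card {z\<in>A. z \<le> x} < card {z\<in>A. z \<le> y} \<longleftrightarrow> x < y"
proof (cases "x < y")
  case True
  then have "{z\<in>A. z \<le> x} \<subset> {z\<in>A. z \<le> y}"
    using assms by force
  then show ?thesis
    using True assms(1) by (simp add: psubset_card_mono)
next
  case False
  then have "{z\<in>A. z \<le> y} \<subseteq> {z\<in>A. z \<le> x}"
    by auto
  then have "card {z\<in>A. z \<le> y} \<le> card {z\<in>A. z \<le> x}"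
    using assms(1) by (intro card_mono) auto
  then show ?thesis
    using False by simp
qed

lemma length_standardize [simp]: "length (standardize xs) = length xs"
  by (simp add: standardize_def)

lemma order_isomorphic_standardize: "order_isomorphic xs (standardize xs)"
  by (auto simp: order_isomorphic_def standardize_def card_le_less_iff)

lemma order_isomorphic_le:
  assumes "order_isomorphic xs ys" "i < length xs" "j < length xs"
  shows "xs ! i \<le> xs ! j \<longleftrightarrow> ys ! i \<le> ys ! j"
  using assms by (auto simp: order_isomorphic_def not_less[symmetric])

lemma standardize_cong:
  assumes "order_isomorphic xs ys"
  shows "standardize xs = standardize ys"
proof (rule nth_equalityI)
  show len: "length (standardize xs) = length (standardize ys)"
    using assms by (simp add: order_isomorphic_def)
  fix i
  assume i: "i < length (standardize xs)"
  have eq: "xs ! j = xs ! k \<longleftrightarrow> ys ! j = ys ! k" if "j < length xs" "k < length xs" for j k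
    using order_isomorphic_le[OF assms] that by (metis antisym order_refl)
  \<comment> \<open>The rank of entry \<open>i\<close> is the number of distinct values on
    \<open>?I\<close>. Entries may repeat, so the two value sets are matched through a chosen index
    for each value.\<close>
  let ?I = "{j. j < length xs \<and> xs ! j \<le> xs ! i}"
  have I: "?I = {j. j < length ys \<and> ys ! j \<le> ys ! i}"
    using order_isomorphic_le[OF assms] i len by auto
  have "card {y\<in>set xs. y \<le> xs ! i} = card ((!) xs ` ?I)"
    by (rule arg_cong[of _ _ card]) (auto simp: in_set_conv_nth)
  also have "\<dots> = card ((!) ys ` ?I)"
  proof (rule bij_betw_same_card[of "\<lambda>x. ys ! (SOME j. j \<in> ?I \<and> xs ! j = x)"])
    have s: "(SOME j. j \<in> ?I \<and> xs ! j = xs ! k) \<in> ?I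
        \<and> xs ! (SOME j. j \<in> ?I \<and> xs ! j = xs ! k) = xs ! k" if "k \<in> ?I" for k
      by (rule someI[of "\<lambda>j. j \<in> ?I \<and> xs ! j = xs ! k" k]) (use that in simp)
    then have "ys ! (SOME j. j \<in> ?I \<and> xs ! j = xs ! k) = ys ! k" if "k \<in> ?I" for k
      using that eq[of _ k] by blast
    then show "bij_betw (\<lambda>x. ys ! (SOME j. j \<in> ?I \<and> xs ! j = x)) ((!) xs ` ?I) ((!) ys ` ?I)"
      unfolding bij_betw_def inj_on_def using eq by (auto simp: image_image)
  qed
  also have "\<dots> = card {y\<in>set ys. y \<le> ys ! i}"
    unfolding I by (rule arg_cong[of _ _ card]) (auto simp: in_set_conv_nth)
  finally show "standardize xs ! i = standardize ys ! i"
    using i len by (simp add: standardize_def)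
qed

lemma is_permD:
  assumes "is_perm xs"
  shows "set xs = {1..length xs}" "distinct xs"
  using assms by (auto simp: is_perm_def permutations_of_set_def)

lemma is_permI:
  assumes "set xs = {1..n}" "distinct xs"
  shows "is_perm xs"
proof -
  have "length xs = n"
    using distinct_card[OF assms(2)] assms(1) by simp
  then show ?thesis
    using assms by (simp add: is_perm_def permutations_of_set_def)
qed

lemma standardize_perm:
  assumes "is_perm xs"
  shows "standardize xs = xs"
proof -
  have "card {y \<in> set xs. y \<le> x} = x" if "x \<in> set xs" for x
  proof -
    have "{y \<in> set xs. y \<le> x} = {1..x}"
      using that is_permD[OF assms] by auto
    then show ?thesis by simp
  qed
  then show ?thesis
    unfolding standardize_def by (intro map_idI)
qed

lemma length_strip:
  assumes "b \<noteq> []"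
  shows "length b = length b - 2 + (if strip_kind b = 0 then 1 else 2)"
  using assms by (cases b) (auto simp: strip_kind_def)

text \<open>The second summand depends on the type alone, so within one type, counting by length is
  counting by coordinate sum up to a shift.\<close>

lemma length_eq_sum_strip_vec:
  "length xs = sum_list (strip_vec xs) + sum_list (map (\<lambda>k. if k = 0 then 1 else 2) (snd (strip_type xs)))"
proof -
  have "length xs = sum_list (map length (strips xs))"
    by (metis concat_strips length_concat)
  also have "\<dots> = sum_list (map (\<lambda>b. length b - 2 + (if strip_kind b = 0 then 1 else 2)) (strips xs))"
    using strip_decomp_strips[of xs]
    by (intro arg_cong[of _ _ sum_list] map_cong refl length_strip) (auto simp: strip_decomp_def)
  finally show ?thesis
    by (simp add: sum_list_addf strip_vec_def strip_type_def comp_def)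
qed

text \<open>Consecutive adjacent entries of a repetition-free list cannot turn around.\<close>

lemma run_eq_upt:
  assumes "successively adj b" "distinct b" "b \<noteq> []"
  shows "b = (if strip_kind b = 2 then rev [Suc (hd b) - length b..<Suc (hd b)]
              else [hd b..<hd b + length b])
    \<and> (strip_kind b = 2 \<longrightarrow> length b \<le> Suc (hd b))"
  using assms
proof (induction b rule: strips.induct)
  case (3 x y zs)
  let ?b = "y # zs"
  note IH = 3(1,2)
  show ?case
  proof (cases zs)
    case Nil
    then show ?thesis
      using 3 by (auto simp: adj_def strip_kind_def)
  next
    case (Cons z zs')
    have k: "strip_kind ?b = (if y < z then 1 else 2)" "strip_kind (x # ?b) = (if x < y then 1 else 2)"
      by (auto simp: strip_kind_def Cons)
    \<comment> \<open>Both neighbours of \<open>y\<close> in the list are adjacent to it in value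
      and they differ, so one is \<open>Suc y\<close> and the other is its predecessor: the
      direction persists.\<close>
    have "adj y z" "adj x y" "x \<noteq> z"
      using 3 Cons by auto
    then have d: "y = Suc x \<and> z = Suc y \<or> x = Suc y \<and> y = Suc z"
      by (auto simp: adj_def)
    \<comment> \<open>The bound on the length says that a descending run does not pass below 0, so
      that \<open>Suc y - length ?b\<close> is not truncated.\<close>
    have IHs: "?b = (if strip_kind ?b = 2 then rev [Suc y - length ?b..<Suc y]
              else [y..<y + length ?b]) \<and> (strip_kind ?b = 2 \<longrightarrow> length ?b \<le> Suc y)"
      using 3 by auto
    have up: "?b = [y..<y + length ?b]" if "strip_kind ?b \<noteq> 2"
      using IHs that by argo
    have down: "?b = rev [Suc y - length ?b..<Suc y]" "length ?b \<le> Suc y" if "strip_kind ?b = 2"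
      using IHs that by argo+
    from d show ?thesis
    proof
      assume "y = Suc x \<and> z = Suc y"
      then have h: "strip_kind ?b \<noteq> 2" "strip_kind (x # ?b) = 1" "y = Suc x"
        using k by auto
      have "[x..<x + length (x # ?b)] = x # [y..<y + length ?b]"
        using h(3) by (simp add: upt_conv_Cons del: upt_Suc)
      also have "\<dots> = x # ?b"
        by (simp only: up[OF h(1), symmetric])
      finally show ?thesis
        using h(2) by (simp del: upt_Suc)
    next
      assume a: "x = Suc y \<and> y = Suc z"
      then have h: "strip_kind ?b = 2" "strip_kind (x # ?b) = 2" "x = Suc y"
        using k by auto
      show ?thesis
        using down[OF h(1)] h(2,3) by (simp add: Suc_diff_le)
    qed
  qed
qed (auto simp: strip_kind_def)

section \<open>Strips as intervals of values, and recovery of the permutation\<close>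

definition strip_min :: "nat list \<Rightarrow> nat" where
  "strip_min b = (if strip_kind b = 2 then Suc (hd b) - length b else hd b)"

lemma run_eq_upt_strip_min:
  assumes "successively adj b" "distinct b" "b \<noteq> []"
  shows "b = (if strip_kind b = 2 then rev [strip_min b..<strip_min b + length b]
              else [strip_min b..<strip_min b + length b])"
  using run_eq_upt[OF assms] by (auto simp: strip_min_def simp del: upt_Suc)

lemma set_run:
  assumes "successively adj b" "distinct b" "b \<noteq> []"
  shows "set b = {strip_min b..<strip_min b + length b}"
proof -
  have "set b = set (if strip_kind b = 2 then rev [strip_min b..<strip_min b + length b]
              else [strip_min b..<strip_min b + length b])"
    using run_eq_upt_strip_min[OF assms] by simp
  then show ?thesis
    by (simp split: if_splits)
qed

lemma strips_perm:
  assumes "is_perm p"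
  shows "(\<Union>b\<in>set (strips p). set b) = {1..length p}" "distinct (strips p)"
    and "b \<in> set (strips p) \<Longrightarrow> b \<noteq> [] \<and> successively adj b \<and> distinct b"
    and "b \<in> set (strips p) \<Longrightarrow> c \<in> set (strips p) \<Longrightarrow> b \<noteq> c \<Longrightarrow> set b \<inter> set c = {}"
proof -
  have s: "strip_decomp (strips p)"
    by (rule strip_decomp_strips)
  have d: "distinct (concat (strips p))"
    using is_permD[OF assms] by simp
  show "(\<Union>b\<in>set (strips p). set b) = {1..length p}"
    using is_permD(1)[OF assms] set_concat[of "strips p"] by simp
  show "distinct (strips p)"
    using s d by (simp add: distinct_concat_iff strip_decomp_def del: concat_strips)
  show "b \<in> set (strips p) \<Longrightarrow> b \<noteq> [] \<and> successively adj b \<and> distinct b"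
    using s d by (auto simp: distinct_concat_iff strip_decomp_def simp del: concat_strips)
  show "b \<in> set (strips p) \<Longrightarrow> c \<in> set (strips p) \<Longrightarrow> b \<noteq> c \<Longrightarrow> set b \<inter> set c = {}"
    using d unfolding distinct_concat_iff by blast
qed

text \<open>The entries below a strip are exactly those of the strips with smaller heads.\<close>

lemma strip_min_eq:
  assumes "is_perm p" "i < length (strips p)"
  shows "strip_min (strips p ! i) = 1 +
    (\<Sum>j | j < length (strips p) \<and> hd (strips p ! j) < hd (strips p ! i). length (strips p ! j))"
proof -
  let ?b = "\<lambda>j. strips p ! j"
  let ?J = "{j. j < length (strips p) \<and> hd (?b j) < hd (?b i)}"
  note sp = strips_perm[OF assms(1)]
  have ne: "?b j \<noteq> []" and iv: "set (?b j) = {strip_min (?b j)..<strip_min (?b j) + length (?b j)}"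
    and len: "card (set (?b j)) = length (?b j)"
    if "j < length (strips p)" for j
    using sp(3)[of "?b j"] that set_run[of "?b j"] by (auto simp: distinct_card)
  have disj: "set (?b j) \<inter> set (?b k) = {}"
    if "j < length (strips p)" "k < length (strips p)" "j \<noteq> k" for j k
    using sp(2) sp(4)[of "?b j" "?b k"] that by (simp add: nth_eq_iff_index_eq)
  have hd: "hd (?b j) \<in> set (?b j)" if "j < length (strips p)" for j
    using ne[OF that] by simp
  have min: "strip_min (?b j) \<in> set (?b j)" if "j < length (strips p)" for j
    using ne[OF that] iv[OF that] by simp
  have sub: "set (?b j) \<subseteq> {1..length p}" if "j < length (strips p)" for j
    unfolding sp(1)[symmetric] using that by (intro UN_upper nth_mem)
  \<comment> \<open>Strips occupy disjoint intervals of values. By this convexity, comparing one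
    entry from each of two strips compares them entirely, which gives both inclusions below.\<close>
  have conv: "z \<in> set (?b j)" if "j < length (strips p)" "x \<in> set (?b j)" "y \<in> set (?b j)" "x \<le> z" "z \<le> y" for x y z j
    using that iv[OF that(1)] by auto
  have "{1..<strip_min (?b i)} = (\<Union>j\<in>?J. set (?b j))" (is "?L = ?R")
  proof
    show "?L \<subseteq> ?R"
    proof
      fix x
      assume x: "x \<in> ?L"
      then have "x \<in> {1..length p}"
        using subsetD[OF sub min, OF assms(2) assms(2)] by auto
      then obtain j where j: "j < length (strips p)" "x \<in> set (?b j)"
        using sp(1) by (metis UN_E in_set_conv_nth)
      have "j \<noteq> i"
        using j x iv by auto
      then have "strip_min (?b i) \<notin> set (?b j)"
        using disj j(1) assms(2) min by blast
      then have "hd (?b j) < strip_min (?b i)"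
        using conv[OF j hd[OF j(1)], of "strip_min (?b i)"] x by force
      also have "\<dots> \<le> hd (?b i)"
        using hd[OF assms(2)] iv[OF assms(2)] by auto
      finally show "x \<in> ?R"
        using j by auto
    qed
    show "?R \<subseteq> ?L"
    proof
      fix x
      assume "x \<in> ?R"
      then obtain j where j: "j < length (strips p)" "hd (?b j) < hd (?b i)" "x \<in> set (?b j)"
        by auto
      then have ji: "j \<noteq> i"
        by auto
      have "hd (?b j) \<notin> set (?b i)" "strip_min (?b i) \<notin> set (?b j)"
        using disj[OF j(1) assms(2) ji] min[OF assms(2)] hd[OF j(1)] by blast+
      then have "hd (?b j) < strip_min (?b i)"
        using conv[OF assms(2) min[OF assms(2)] hd[OF assms(2)], of "hd (?b j)"] j(2) by force
      then have "x < strip_min (?b i)"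
        using conv[OF j(1) hd[OF j(1)] j(3), of "strip_min (?b i)"]
          \<open>strip_min (?b i) \<notin> set (?b j)\<close> by force
      moreover have "x \<in> {1..length p}"
        using sub[OF j(1)] j(3) by blast
      ultimately show "x \<in> ?L"
        by simp
    qed
  qed
  then have "strip_min (?b i) - 1 = card (\<Union>j\<in>?J. set (?b j))"
    by (metis card_atLeastLessThan)
  also have "\<dots> = (\<Sum>j\<in>?J. card (set (?b j)))"
    by (rule card_UN_disjoint) (simp, simp, use disj in blast)
  also have "\<dots> = (\<Sum>j\<in>?J. length (?b j))"
    by (intro sum.cong refl) (simp add: len)
  finally have "strip_min (?b i) - 1 = (\<Sum>j\<in>?J. length (?b j))" .
  moreover have "strip_min (?b i) \<ge> 1"
    using subsetD[OF sub min, OF assms(2) assms(2)] by auto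
  ultimately show ?thesis
    by simp
qed

text \<open>Kinds and excesses give the strip lengths; these and the order of the heads give every
  least entry through \<open>strip_min_eq\<close>; kind, length and least entry determine a
  strip.\<close>

lemma strip_type_vec_inject:
  assumes pq: "is_perm p" "is_perm q"
    and ty: "strip_type p = strip_type q" and vec: "strip_vec p = strip_vec q"
  shows "p = q"
proof -
  let ?b = "\<lambda>j. strips p ! j" and ?c = "\<lambda>j. strips q ! j"
  have m: "length (strips p) = length (strips q)"
    using arg_cong[OF vec, of length] by (simp add: strip_vec_def)
  have kind: "strip_kind (?b j) = strip_kind (?c j)" if "j < length (strips q)" for j
    using ty that m unfolding strip_type_def by (metis nth_map prod.inject)
  have "length (?b j) - 2 = length (?c j) - 2" if "j < length (strips q)" for j
    using vec that m nth_map[of j "strips p" "\<lambda>b. length b - 2"] nth_map[of j "strips q" "\<lambda>b. length b - 2"]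
    unfolding strip_vec_def by metis
  then have len: "length (?b j) = length (?c j)" if "j < length (strips q)" for j
    using length_strip[of "?b j"] length_strip[of "?c j"] kind[OF that] that m
      strips_perm(3)[OF pq(1), of "?b j"] strips_perm(3)[OF pq(2), of "?c j"] by auto
  have "standardize (map hd (strips p)) = standardize (map hd (strips q))"
    using ty by (simp add: strip_type_def)
  \<comment> \<open>Both lists of heads are order isomorphic to their common
    standardization.\<close>
  then have hd: "hd (?b j) < hd (?b i) \<longleftrightarrow> hd (?c j) < hd (?c i)"
    if "i < length (strips q)" "j < length (strips q)" for i j
    using order_isomorphic_standardize[of "map hd (strips p)"]
      order_isomorphic_standardize[of "map hd (strips q)"] that m
    by (simp add: order_isomorphic_def)
  have min: "strip_min (?b i) = strip_min (?c i)" if "i < length (strips q)" for i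
  proof -
    have "{j. j < length (strips q) \<and> hd (?b j) < hd (?b i)}
        = {j. j < length (strips q) \<and> hd (?c j) < hd (?c i)}"
      using hd that by blast
    moreover have "(\<Sum>j | j < length (strips q) \<and> hd (?c j) < hd (?c i). length (?b j))
        = (\<Sum>j | j < length (strips q) \<and> hd (?c j) < hd (?c i). length (?c j))"
      by (rule sum.cong) (auto simp: len)
    ultimately show ?thesis
      using strip_min_eq[OF pq(1), of i] strip_min_eq[OF pq(2), of i] that m by simp
  qed
  have "strips p = strips q"
  proof (rule nth_equalityI[OF m])
    fix i
    assume i: "i < length (strips p)"
    let ?R = "\<lambda>b. if strip_kind b = 2 then rev [strip_min b..<strip_min b + length b]
              else [strip_min b..<strip_min b + length b]"
    have "?b i = ?R (?b i)"
      using strips_perm(3)[OF pq(1), of "?b i"] i by (intro run_eq_upt_strip_min) auto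
    also have "\<dots> = ?R (?c i)"
      using i m by (simp only: kind len min)
    also have "\<dots> = ?c i"
      using strips_perm(3)[OF pq(2), of "?c i"] i m by (intro run_eq_upt_strip_min[symmetric]) auto
    finally show "?b i = ?c i" .
  qed
  then show ?thesis
    by (metis concat_strips)
qed

section \<open>Finiteness of the set of types\<close>

lemma finite_strip_types: "finite (strip_type ` {p. length (strips p) \<le> M})"
proof (rule finite_subset)
  let ?L = "\<lambda>m. {xs :: nat list. set xs \<subseteq> {..m} \<and> length xs \<le> M}"
  show "finite (?L M \<times> ?L 2)"
    by (intro finite_cartesian_product finite_lists_length_le) auto
  have "card {y \<in> set xs. y \<le> x} \<le> length xs" for x and xs :: "nat list"
    by (rule order_trans[OF card_mono[of "set xs"] card_length]) auto
  then have "x \<le> M" if "x \<in> set (standardize xs)" "length xs \<le> M" for x xs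
    using that by (auto simp: standardize_def intro: order_trans)
  moreover have "strip_kind b \<le> 2" for b
    by (simp add: strip_kind_def)
  ultimately show "strip_type ` {p. length (strips p) \<le> M} \<subseteq> ?L M \<times> ?L 2"
    by (auto simp: strip_type_def)
qed

section \<open>Deleting an inner entry of a strip\<close>

definition close_gap :: "nat \<Rightarrow> nat \<Rightarrow> nat" where
  "close_gap x y = (if y < x then y else y - 1)"

lemma close_gap_less:
  "y \<noteq> x \<Longrightarrow> z \<noteq> x \<Longrightarrow> close_gap x y < close_gap x z \<longleftrightarrow> y < z"
  by (auto simp: close_gap_def)

text \<open>Closing the gap at \<open>x\<close> preserves all adjacencies and creates just one,
  between the two values next to \<open>x\<close>.\<close>

lemma adj_close_gap:
  assumes "y \<noteq> x" "z \<noteq> x"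
  shows "adj (close_gap x y) (close_gap x z) \<longleftrightarrow>
    adj y z \<or> Suc y = x \<and> z = Suc x \<or> Suc z = x \<and> y = Suc x"
  using assms by (auto simp: close_gap_def adj_def)

text \<open>Delete the second entry \<open>x\<close> of a strip with at least three entries and
  renumber. Its neighbours in the strip are the two values next to \<open>x\<close>, so the strip
  closes up, while no other pair becomes adjacent and the order of the heads is kept.\<close>

lemma delete_strip_entry:
  assumes p: "is_perm p" and i: "i < length (strip_vec p)" "strip_vec p ! i > 0"
  obtains q where "is_perm q" "is_pattern_of q p" "strip_type q = strip_type p"
    "strip_vec q = (strip_vec p)[i := strip_vec p ! i - 1]"
proof -
  let ?b = "strips p ! i"
  have i': "i < length (strips p)" "length ?b \<ge> 3"
    using i by (auto simp: strip_vec_def)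
  define B1 B2 where "B1 = take i (strips p)" and "B2 = drop (Suc i) (strips p)"
  obtain a x c r where b: "?b = a # x # c # r"
    using i'(2) by (metis Suc_le_length_iff eval_nat_numeral(3) numeral_2_eq_2)
  have bs: "strips p = B1 @ (a # x # c # r) # B2"
    unfolding B1_def B2_def b[symmetric] by (rule id_take_nth_drop[OF i'(1)])
  have B1: "length B1 = i"
    using i'(1) by (simp add: B1_def)
  have pc: "p = concat (B1 @ (a # x # c # r) # B2)"
    using bs by (metis concat_strips)
  have dec: "strip_decomp (B1 @ (a # x # c # r) # B2)"
    using bs strip_decomp_strips[of p] by simp
  have dist: "distinct (concat (B1 @ (a # x # c # r) # B2))"
    using pc is_permD(2)[OF p] by simp
  \<comment> \<open>Since \<open>a\<close> and \<open>c\<close> are distinct and both adjacent to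
    \<open>x\<close>, they lie on opposite sides of \<open>x\<close>.\<close>
  have ac: "Suc a = x \<and> c = Suc x \<or> Suc c = x \<and> a = Suc x"
    using dec dist by (auto simp: strip_decomp_def adj_def)
  define f where "f = close_gap x"
  define ds where "ds = B1 @ (a # c # r) # B2"
  define ys where "ys = concat ds"
  define q where "q = map f ys"
  have xys: "x \<notin> set ys" and dys: "distinct ys" and sys: "set p = insert x (set ys)"
    using dist unfolding ys_def ds_def pc by auto
  have x1: "x \<in> {1..length p}" and sys': "set ys = {1..length p} - {x}"
    using sys xys is_permD(1)[OF p] by auto
  have fless: "f y < f z \<longleftrightarrow> y < z" if "y \<in> set ys" "z \<in> set ys" for y z
    unfolding f_def by (rule close_gap_less) (use that xys in auto)
  have "is_perm q"
  proof (rule is_permI)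
    show "set q = {1..length p - 1}"
    proof -
      have "f ` ({1..length p} - {x}) = {1..length p - 1}"
      proof
        show "f ` ({1..length p} - {x}) \<subseteq> {1..length p - 1}"
          using x1 by (auto simp: f_def close_gap_def)
        show "{1..length p - 1} \<subseteq> f ` ({1..length p} - {x})"
        proof
          fix y
          assume y: "y \<in> {1..length p - 1}"
          then show "y \<in> f ` ({1..length p} - {x})"
            by (intro image_eqI[of _ _ "if y < x then y else Suc y"]) (auto simp: f_def close_gap_def)
        qed
      qed
      then show ?thesis
        by (simp add: q_def sys')
    qed
    show "distinct q"
    proof -
      have "inj_on f (set ys)"
      proof (rule inj_onI)
        fix y z
        assume "y \<in> set ys" "z \<in> set ys" "f y = f z"
        then show "y = z"
          using fless[of y z] fless[of z y] by simp
      qed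
      then show ?thesis
        unfolding q_def distinct_map using dys by simp
    qed
  qed
  moreover have "is_pattern_of q p"
    unfolding is_pattern_of_def
  proof (intro exI conjI)
    show "subseq ys p"
      unfolding ys_def ds_def pc by (auto intro!: list_emb_append_mono)
    show "order_isomorphic q ys"
      unfolding order_isomorphic_def q_def using fless by simp
  qed
  moreover have sq: "strips q = map (map f) ds"
  proof -
    have nz: "y \<noteq> x" if "y \<in> set e" "e \<in> set ds" for y e
      using that xys unfolding ys_def by auto
    have runs: "successively adj e" if "e \<in> set ds" "e \<noteq> a # c # r" for e
      using that dec unfolding ds_def strip_decomp_def by auto
    have adjf: "successively (\<lambda>y z. adj (f y) (f z)) e" if "successively adj e" "x \<notin> set e" for e
      using that(1) by (rule successively_mono) (use that(2) in \<open>metis adj_close_gap f_def\<close>)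
    have "successively adj (c # r)"
      using dec by (auto simp: strip_decomp_def)
    then have "successively (\<lambda>y z. adj (f y) (f z)) (c # r)"
      by (rule adjf) (use dist in auto)
    moreover have "adj (f a) (f c)"
      using ac by (auto simp: f_def adj_close_gap)
    ultimately have 1: "successively adj (map f (a # c # r))"
      by (simp only: successively_map successively.simps)
    have 2: "successively adj (map f e)" if "e \<in> set ds" for e
    proof (cases "e = a # c # r")
      case False
      then show ?thesis
        using adjf[OF runs[OF that False]] nz[OF _ that] by (auto simp: successively_map)
    qed (use 1 in simp)
    let ?P = "\<lambda>u v. \<not> adj (last u) (hd v)" and ?Q = "\<lambda>u v. \<not> adj (f (last u)) (f (hd v))"
    \<comment> \<open>The only new adjacency is between \<open>a\<close> and \<open>c\<close>, both
      inside the shortened strip. A boundary with at most one side in \<open>{a, c}\<close>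
      therefore remains a boundary.\<close>
    have PQ: "?Q u v" if "?P u v" "u \<in> set ds" "v \<in> set ds" "u \<noteq> []" "v \<noteq> []"
        "last u \<notin> {a, c} \<or> hd v \<notin> {a, c}" for u v
    proof -
      have "last u \<noteq> x" "hd v \<noteq> x"
        using that nz by (auto intro: last_in_set hd_in_set)
      then show ?thesis
        using that(1,6) ac unfolding f_def by (auto simp: adj_close_gap)
    qed
    have out: "y \<notin> {a, c}" if "y \<in> set e" "e \<in> set B1 \<union> set B2" for y e
      using dist that by auto
    have ne: "[] \<notin> set B1" "[] \<notin> set B2"
      using dec by (auto simp: strip_decomp_def)
    have s: "successively ?P B1" "successively ?P B2" "B1 \<noteq> [] \<Longrightarrow> \<not> adj (last (last B1)) a"
      "B2 \<noteq> [] \<Longrightarrow> \<not> adj (last (c # r)) (hd (hd B2))"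
      using dec by (auto simp: strip_decomp_def successively_append_iff successively_Cons)
    have PQ': "?Q u v" if "?P u v" "u \<in> set B1 \<union> set B2" "v \<in> set B1 \<union> set B2" for u v
    proof (rule PQ[OF that(1)])
      show u: "u \<noteq> []" and "v \<noteq> []"
        using that ne by auto
      show "last u \<notin> {a, c} \<or> hd v \<notin> {a, c}"
        using out[OF last_in_set[OF u] that(2)] ..
    qed (use that in \<open>auto simp: ds_def\<close>)
    have "successively ?Q B1"
      using s(1) by (rule successively_mono) (use PQ' in blast)
    moreover have "successively ?Q B2"
      using s(2) by (rule successively_mono) (use PQ' in blast)
    moreover have "?Q (last B1) (a # c # r)" if "B1 \<noteq> []"
    proof (rule PQ)
      have l: "last B1 \<in> set B1" "last B1 \<noteq> []"
        using that ne last_in_set by metis+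
      then show "last B1 \<noteq> []" "last B1 \<in> set ds" "last (last B1) \<notin> {a, c} \<or> hd (a # c # r) \<notin> {a, c}"
        using out[OF last_in_set] by (auto simp: ds_def)
    qed (use s(3) that in \<open>auto simp: ds_def\<close>)
    moreover have "?Q (a # c # r) (hd B2)" if "B2 \<noteq> []"
    proof (rule PQ)
      have l: "hd B2 \<in> set B2" "hd B2 \<noteq> []"
        using that ne hd_in_set by metis+
      then show "hd B2 \<noteq> []" "hd B2 \<in> set ds" "last (a # c # r) \<notin> {a, c} \<or> hd (hd B2) \<notin> {a, c}"
        using out[OF hd_in_set] by (auto simp: ds_def)
    qed (use s(4) that in \<open>auto simp: ds_def\<close>)
    ultimately have Q: "successively ?Q ds"
      unfolding ds_def by (auto simp: successively_append_iff successively_Cons)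
    have "[] \<notin> set ds"
      using ne by (auto simp: ds_def)
    from Q have "successively (\<lambda>u v. \<not> adj (last (map f u)) (hd (map f v))) ds"
    proof (rule successively_mono)
      fix u v
      assume "u \<in> set ds" "v \<in> set ds" "?Q u v"
      then show "\<not> adj (last (map f u)) (hd (map f v))"
        using \<open>[] \<notin> set ds\<close> last_map[of u f] hd_map[of v f] by metis
    qed
    then have "strip_decomp (map (map f) ds)"
      using 2 \<open>[] \<notin> set ds\<close> by (auto simp: strip_decomp_def successively_map)
    then show ?thesis
      unfolding q_def ys_def map_concat by (rule strips_concat)
  qed
  moreover have "strip_type q = strip_type p"
  proof -
    have ne: "[] \<notin> set ds"
      using dec by (auto simp: strip_decomp_def ds_def)
    have "map hd (strips q) = map f (map hd ds)"
      using ne unfolding sq by (auto intro!: hd_map)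
    moreover have "order_isomorphic (map f (map hd ds)) (map hd ds)"
    proof -
      have "hd (ds ! j) \<in> set ys" if "j < length ds" for j
      proof -
        have "ds ! j \<in> set ds" "ds ! j \<noteq> []"
          using that ne nth_mem by metis+
        then show ?thesis
          unfolding ys_def by (auto intro!: bexI[of _ "ds ! j"])
      qed
      then show ?thesis
        using fless by (simp add: order_isomorphic_def)
    qed
    moreover have "map hd ds = map hd (strips p)"
      by (simp add: ds_def bs)
    ultimately have "standardize (map hd (strips q)) = standardize (map hd (strips p))"
      using standardize_cong by metis
    moreover have "map strip_kind (strips q) = map strip_kind (strips p)"
    proof -
      have "strip_kind (map f e) = strip_kind e" if "e \<in> set ds" for e
      proof (cases "length e \<le> 1")
        case False
        then have l: "0 < length e" "1 < length e"
          by auto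
        have "set e \<subseteq> set ys"
          using that by (auto simp: ys_def)
        then have "f (e ! 0) < f (e ! 1) \<longleftrightarrow> e ! 0 < e ! 1"
          using l nth_mem by (intro fless) blast+
        then show ?thesis
          using l by (simp add: strip_kind_def)
      qed (simp add: strip_kind_def)
      then have "map strip_kind (strips q) = map strip_kind ds"
        unfolding sq by simp
      \<comment> \<open>The shortened strip keeps its direction, since \<open>c\<close> lies on the
        same side of \<open>a\<close> as \<open>x\<close> does.\<close>
      also have "\<dots> = map strip_kind (strips p)"
        using ac by (auto simp: ds_def bs strip_kind_def)
      finally show ?thesis .
    qed
    ultimately show ?thesis
      by (simp add: strip_type_def)
  qed
  moreover have "strip_vec q = (strip_vec p)[i := strip_vec p ! i - 1]"
    using B1 unfolding strip_vec_def sq bs ds_def by (auto simp: comp_def nth_append list_update_append)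
  ultimately show ?thesis
    using that by blast
qed

text \<open>Split the class by type. On one type \<open>strip_vec\<close> is injective, and its
  image is a down-set because deletions stay in the class; finitely many eventually polynomial
  counts are then added.\<close>

lemma polynomial_class_if_bounded_strips:
  assumes C: "permutation_class C" and M: "\<And>p. p \<in> C \<Longrightarrow> length (strips p) \<le> M"
  shows "polynomial_class C"
proof -
  define T where "T = strip_type ` C"
  define D where "D t = strip_vec ` {p\<in>C. strip_type p = t}" for t
  \<comment> \<open>This is the length belonging to type \<open>t\<close> when all excesses are 0: 1
    for each singleton and 2 for each proper run.\<close>
  define w :: "nat list \<times> nat list \<Rightarrow> nat"
    where "w t = sum_list (map (\<lambda>k. if k = 0 then 1 else 2) (snd t))" for t
  have perm: "is_perm p" if "p \<in> C" for p
    using C that by (simp add: permutation_class_def)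
  have finT: "finite T"
    unfolding T_def by (rule finite_subset[OF _ finite_strip_types[of M]]) (auto dest: M)
  have "v[i := v ! i - 1] \<in> D t" if v: "v \<in> D t" "i < length v" "v ! i > 0" for v i t
  proof -
    obtain p where p: "p \<in> C" "strip_type p = t" "v = strip_vec p"
      using v(1) by (auto simp: D_def)
    obtain q where "is_perm q" "is_pattern_of q p" "strip_type q = t" "strip_vec q = v[i := v ! i - 1]"
      using v(2,3) unfolding p(2)[symmetric] p(3) by (rule delete_strip_entry[OF perm[OF p(1)]])
    moreover have "q \<in> C"
      using C p(1) calculation(1,2) unfolding permutation_class_def by blast
    ultimately show ?thesis
      unfolding D_def by (metis (mono_tags, lifting) imageI mem_Collect_eq)
  qed
  then have dc: "down_closed (D t)" for t
    using down_closed_if_decrement by blast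
  have lenD: "length v = length (snd t)" if "v \<in> D t" for v t
    using that by (auto simp: D_def strip_vec_def strip_type_def)
  have ep: "eventually_poly (\<lambda>n. real (card {v\<in>D t. sum_list v = n - w t}))" for t
    using eventually_poly_shift[OF eventually_poly_down_closed[OF dc lenD]] .
  have "eventually_poly (\<lambda>n. \<Sum>t\<in>T. real (card {v\<in>D t. sum_list v = n - w t}))"
    by (intro eventually_poly_sum ep)
  \<comment> \<open>The bound on \<open>n\<close> dominates every single \<open>w t\<close>, so none
    of the subtractions \<open>n - w t\<close> is truncated.\<close>
  moreover have "real (card {p\<in>C. length p = n}) = (\<Sum>t\<in>T. real (card {v\<in>D t. sum_list v = n - w t}))"
    if n: "n \<ge> (\<Sum>t\<in>T. w t)" for n
  proof -
    let ?S = "\<lambda>t. {p\<in>C. strip_type p = t \<and> length p = n}"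
    have "finite {p\<in>C. length p = n}"
      by (rule finite_subset[OF _ finite_lists_length_eq[of "{1..n}" n]]) (auto dest!: perm is_permD(1))
    then have fin: "finite (?S t)" for t
      by (rule finite_subset[rotated]) auto
    have "{p\<in>C. length p = n} = (\<Union>t\<in>T. ?S t)"
      by (auto simp: T_def)
    also have "card \<dots> = (\<Sum>t\<in>T. card (?S t))"
      by (rule card_UN_disjoint) (use finT fin in auto)
    also have "\<dots> = (\<Sum>t\<in>T. card {v\<in>D t. sum_list v = n - w t})"
    proof (rule sum.cong[OF refl])
      fix t
      assume "t \<in> T"
      then have wt: "w t \<le> n"
        using n member_le_sum[of t T w] finT by auto
      have len: "length p = n \<longleftrightarrow> sum_list (strip_vec p) = n - w t" if "strip_type p = t" for p
        using length_eq_sum_strip_vec[of p] wt that by (auto simp: w_def)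
      have "{v\<in>D t. sum_list v = n - w t} = strip_vec ` ?S t"
        using len by (auto simp: D_def)
      moreover have "inj_on strip_vec (?S t)"
        using strip_type_vec_inject perm by (auto simp: inj_on_def)
      ultimately show "card (?S t) = card {v\<in>D t. sum_list v = n - w t}"
        by (simp add: card_image)
    qed
    finally show ?thesis
      by simp
  qed
  ultimately have "eventually_poly (\<lambda>n. real (card {p\<in>C. length p = n}))"
    by (rule eventually_poly_cong)
  then show ?thesis
    using C unfolding polynomial_class_def eventually_poly_def by blast
qed

section \<open>Sorting operations and patterns\<close>

text \<open>Moving a block in either direction exchanges it with the segment \<open>w\<close> that
  it passes; \<open>u \<noteq> a\<close> says that this segment is nonempty. The symmetric form is
  easier to map, filter and count in.\<close>

lemma block_transposition_iff:
  "block_transposition xs ys \<longleftrightarrow>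
     (\<exists>a b c d. b \<noteq> [] \<and> c \<noteq> [] \<and> xs = a @ b @ c @ d \<and> ys = a @ c @ b @ d)"
proof
  assume "block_transposition xs ys"
  then obtain a b c u v where h: "b \<noteq> []" "xs = a @ b @ c" "a @ c = u @ v" "u \<noteq> a" "ys = u @ b @ v"
    by (auto simp: block_transposition_def)
  from h(3) consider w where "u = a @ w" "c = w @ v" | w where "a = u @ w" "v = w @ c"
    by (auto simp: append_eq_append_conv2)
  then show "\<exists>a b c d. b \<noteq> [] \<and> c \<noteq> [] \<and> xs = a @ b @ c @ d \<and> ys = a @ c @ b @ d"
  proof cases
    case 1
    then show ?thesis
      using h by (intro exI[of _ a] exI[of _ b] exI[of _ w] exI[of _ v]) auto
  next
    case 2
    then show ?thesis
      using h by (intro exI[of _ u] exI[of _ w] exI[of _ b] exI[of _ c]) auto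
  qed
next
  assume "\<exists>a b c d. b \<noteq> [] \<and> c \<noteq> [] \<and> xs = a @ b @ c @ d \<and> ys = a @ c @ b @ d"
  then obtain a b c d where "b \<noteq> []" "c \<noteq> []" "xs = a @ b @ c @ d" "ys = a @ c @ b @ d"
    by blast
  then show "block_transposition xs ys"
    unfolding block_transposition_def
    by (intro exI[of _ a] exI[of _ b] exI[of _ "c @ d"] exI[of _ "a @ c"] exI[of _ d]) auto
qed

text \<open>As for transpositions, but the moved block may be reversed. It is the left block when
  moving right and the right block when moving left, hence three outcomes.\<close>

lemma cut_paste_iff:
  "cut_paste xs ys \<longleftrightarrow>
     (\<exists>a b c d. b \<noteq> [] \<and> c \<noteq> [] \<and> xs = a @ b @ c @ d \<and>
        (ys = a @ c @ b @ d \<or> ys = a @ c @ rev b @ d \<or> ys = a @ rev c @ b @ d))"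
proof
  assume "cut_paste xs ys"
  then obtain a b c u v where h: "b \<noteq> []" "xs = a @ b @ c" "a @ c = u @ v" "u \<noteq> a"
    "ys = u @ b @ v \<or> ys = u @ rev b @ v"
    by (auto simp: cut_paste_def)
  from h(3) consider w where "u = a @ w" "c = w @ v" | w where "a = u @ w" "v = w @ c"
    by (auto simp: append_eq_append_conv2)
  then show "\<exists>a b c d. b \<noteq> [] \<and> c \<noteq> [] \<and> xs = a @ b @ c @ d \<and>
        (ys = a @ c @ b @ d \<or> ys = a @ c @ rev b @ d \<or> ys = a @ rev c @ b @ d)"
  proof cases
    case 1
    then show ?thesis
      using h by (intro exI[of _ a] exI[of _ b] exI[of _ w] exI[of _ v]) auto
  next
    case 2
    then show ?thesis
      using h by (intro exI[of _ u] exI[of _ w] exI[of _ b] exI[of _ c]) auto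
  qed
next
  assume "\<exists>a b c d. b \<noteq> [] \<and> c \<noteq> [] \<and> xs = a @ b @ c @ d \<and>
        (ys = a @ c @ b @ d \<or> ys = a @ c @ rev b @ d \<or> ys = a @ rev c @ b @ d)"
  then obtain a b c d where h: "b \<noteq> []" "c \<noteq> []" "xs = a @ b @ c @ d"
    "ys = a @ c @ b @ d \<or> ys = a @ c @ rev b @ d \<or> ys = a @ rev c @ b @ d"
    by blast
  show "cut_paste xs ys"
  proof (cases "ys = a @ rev c @ b @ d")
    case True
    then show ?thesis
      unfolding cut_paste_def
      using h(1,2) by (intro exI[of _ "a @ b"] exI[of _ c] exI[of _ d] exI[of _ a] exI[of _ "b @ d"] conjI)
        (simp_all add: h(3))
  next
    case False
    then have "ys = (a @ c) @ b @ d \<or> ys = (a @ c) @ rev b @ d"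
      using h(4) by simp
    then show ?thesis
      unfolding cut_paste_def
      using h(1,2) by (intro exI[of _ a] exI[of _ b] exI[of _ "c @ d"] exI[of _ "a @ c"] exI[of _ d] conjI)
        (simp_all add: h(3))
  qed
qed

lemma cut_pasteI:
  assumes "b \<noteq> []" "c \<noteq> []"
  shows "cut_paste (a @ b @ c @ d) (a @ c @ b @ d)"
    and "cut_paste (a @ b @ c @ d) (a @ c @ rev b @ d)"
    and "cut_paste (a @ b @ c @ d) (a @ rev c @ b @ d)"
  unfolding cut_paste_iff using assms by blast+

text \<open>This serves passing to patterns: when deleting entries empties one of the two blocks of
  a cut-paste, a reversal in place may remain. A change forces the reversed block to have at least
  two entries.\<close>

lemma block_reversal_imp_cut_paste:
  assumes "block_reversal xs ys" "xs \<noteq> ys"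
  shows "cut_paste xs ys"
proof -
  obtain a b c where h: "b \<noteq> []" "xs = a @ b @ c" "ys = a @ rev b @ c"
    using assms(1) by (auto simp: block_reversal_def)
  obtain b' x where b: "b = b' @ [x]"
    using h(1) by (metis append_butlast_last_id)
  have "b' \<noteq> []"
    using assms(2) h b by auto
  then show ?thesis
    using cut_pasteI(2)[of b' "[x]" a c] by (simp add: h b)
qed

section \<open>Compatibility of the operations with relabelling and deletion of entries\<close>

lemma op_step_map:
  assumes "op_step f xs ys"
  shows "op_step f (map g xs) (map g ys)"
proof (cases f)
  case Block_Reversal
  obtain a b c where "b \<noteq> []" "xs = a @ b @ c" "ys = a @ rev b @ c"
    using assms by (auto simp: Block_Reversal block_reversal_def)
  then show ?thesis
    unfolding Block_Reversal op_step.simps block_reversal_def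
    by (intro exI[of _ "map g a"] exI[of _ "map g b"] exI[of _ "map g c"]) (simp add: rev_map)
next
  case Block_Transposition
  obtain a b c d where "b \<noteq> []" "c \<noteq> []" "xs = a @ b @ c @ d" "ys = a @ c @ b @ d"
    using assms by (auto simp: Block_Transposition block_transposition_iff)
  then show ?thesis
    unfolding Block_Transposition op_step.simps block_transposition_iff
    by (intro exI[of _ "map g a"] exI[of _ "map g b"] exI[of _ "map g c"] exI[of _ "map g d"]) simp
next
  case Block_Interchange
  obtain a b c d e where "b \<noteq> []" "d \<noteq> []" "xs = a @ b @ c @ d @ e" "ys = a @ d @ c @ b @ e"
    using assms by (auto simp: Block_Interchange block_interchange_def)
  then show ?thesis
    unfolding Block_Interchange op_step.simps block_interchange_def
    by (intro exI[of _ "map g a"] exI[of _ "map g b"] exI[of _ "map g c"] exI[of _ "map g d"] exI[of _ "map g e"]) simp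
next
  case Prefix_Transposition
  obtain b u v where "b \<noteq> []" "u \<noteq> []" "xs = b @ u @ v" "ys = u @ b @ v"
    using assms by (auto simp: Prefix_Transposition prefix_transposition_def)
  then show ?thesis
    unfolding Prefix_Transposition op_step.simps prefix_transposition_def
    by (intro exI[of _ "map g b"] exI[of _ "map g (u @ v)"] exI[of _ "map g u"] exI[of _ "map g v"]) simp
next
  case Prefix_Reversal
  obtain b c where "b \<noteq> []" "xs = b @ c" "ys = rev b @ c"
    using assms by (auto simp: Prefix_Reversal prefix_reversal_def)
  then show ?thesis
    unfolding Prefix_Reversal op_step.simps prefix_reversal_def
    by (intro exI[of _ "map g b"] exI[of _ "map g c"]) (simp add: rev_map)
next
  case Cut_Paste
  obtain a b c d where "b \<noteq> []" "c \<noteq> []" "xs = a @ b @ c @ d"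
      "ys = a @ c @ b @ d \<or> ys = a @ c @ rev b @ d \<or> ys = a @ rev c @ b @ d"
    using assms by (auto simp: Cut_Paste cut_paste_iff)
  then show ?thesis
    using cut_pasteI[of "map g b" "map g c" "map g a" "map g d"]
    by (elim disjE) (simp_all add: Cut_Paste rev_map)
qed

text \<open>Filter every block of the step separately. If the blocks that must be nonempty survive,
  the same operation applies; otherwise the step degenerates to no change or to another instance of
  the same operation.\<close>

lemma op_step_filter:
  assumes "op_step f xs ys"
  shows "filter P xs = filter P ys \<or> op_step f (filter P xs) (filter P ys)"
proof (cases f)
  case Block_Reversal
  obtain a b c where h: "b \<noteq> []" "xs = a @ b @ c" "ys = a @ rev b @ c"
    using assms by (auto simp: Block_Reversal block_reversal_def)
  show ?thesis
  proof (cases "filter P b = []")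
    case False
    then have "block_reversal (filter P xs) (filter P ys)"
      unfolding block_reversal_def using h
      by (intro exI[of _ "filter P a"] exI[of _ "filter P b"] exI[of _ "filter P c"]) (simp add: rev_filter)
    then show ?thesis
      by (simp add: Block_Reversal)
  qed (simp add: h rev_filter[symmetric])
next
  case Block_Transposition
  obtain a b c d where h: "b \<noteq> []" "c \<noteq> []" "xs = a @ b @ c @ d" "ys = a @ c @ b @ d"
    using assms by (auto simp: Block_Transposition block_transposition_iff)
  show ?thesis
  proof (cases "filter P b = [] \<or> filter P c = []")
    case False
    then have "block_transposition (filter P xs) (filter P ys)"
      unfolding block_transposition_iff using h
      by (intro exI[of _ "filter P a"] exI[of _ "filter P b"] exI[of _ "filter P c"] exI[of _ "filter P d"]) simp
    then show ?thesis
      by (simp add: Block_Transposition)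
  qed (auto simp: h)
next
  case Block_Interchange
  obtain a b c d e where h: "b \<noteq> []" "d \<noteq> []" "xs = a @ b @ c @ d @ e" "ys = a @ d @ c @ b @ e"
    using assms by (auto simp: Block_Interchange block_interchange_def)
  text \<open>If only one of the two blocks survives, it trades places with the block between them.\<close>
  have bi: "block_interchange (u @ r @ s @ v) (u @ s @ r @ v)" if "r \<noteq> []" "s \<noteq> []"
    for u r s v :: "nat list"
    unfolding block_interchange_def using that
    by (intro exI[of _ u] exI[of _ r] exI[of _ "[]"] exI[of _ s] exI[of _ v]) simp
  let ?a = "filter P a" and ?b = "filter P b" and ?c = "filter P c" and ?d = "filter P d" and ?e = "filter P e"
  have eqs: "filter P xs = ?a @ ?b @ ?c @ ?d @ ?e" "filter P ys = ?a @ ?d @ ?c @ ?b @ ?e"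
    by (simp_all add: h)
  consider "?b \<noteq> []" "?d \<noteq> []" | "?b = []" "?d = []" | "?c = []" "?b = [] \<or> ?d = []"
    | "?b = []" "?c \<noteq> []" "?d \<noteq> []" | "?d = []" "?c \<noteq> []" "?b \<noteq> []"
    by blast
  then have "filter P xs = filter P ys \<or> block_interchange (filter P xs) (filter P ys)"
  proof cases
    case 1
    then show ?thesis
      unfolding eqs block_interchange_def by blast
  qed (use bi[of ?c ?d ?a ?e] bi[of ?b ?c ?a ?e] in \<open>auto simp: eqs\<close>)
  then show ?thesis
    by (simp add: Block_Interchange)
next
  case Prefix_Transposition
  obtain b u v where h: "b \<noteq> []" "u \<noteq> []" "xs = b @ u @ v" "ys = u @ b @ v"
    using assms by (auto simp: Prefix_Transposition prefix_transposition_def)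
  show ?thesis
  proof (cases "filter P b = [] \<or> filter P u = []")
    case False
    then have "prefix_transposition (filter P xs) (filter P ys)"
      unfolding prefix_transposition_def using h
      by (intro exI[of _ "filter P b"] exI[of _ "filter P (u @ v)"] exI[of _ "filter P u"] exI[of _ "filter P v"]) simp
    then show ?thesis
      by (simp add: Prefix_Transposition)
  qed (auto simp: h)
next
  case Prefix_Reversal
  obtain b c where h: "b \<noteq> []" "xs = b @ c" "ys = rev b @ c"
    using assms by (auto simp: Prefix_Reversal prefix_reversal_def)
  show ?thesis
  proof (cases "filter P b = []")
    case False
    then have "prefix_reversal (filter P xs) (filter P ys)"
      unfolding prefix_reversal_def using h
      by (intro exI[of _ "filter P b"] exI[of _ "filter P c"]) (simp add: rev_filter)
    then show ?thesis
      by (simp add: Prefix_Reversal)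
  qed (simp add: h rev_filter[symmetric])
next
  case Cut_Paste
  obtain a b c d where h: "b \<noteq> []" "c \<noteq> []" "xs = a @ b @ c @ d"
      "ys = a @ c @ b @ d \<or> ys = a @ c @ rev b @ d \<or> ys = a @ rev c @ b @ d"
    using assms by (auto simp: Cut_Paste cut_paste_iff)
  let ?a = "filter P a" and ?b = "filter P b" and ?c = "filter P c" and ?d = "filter P d"
  \<comment> \<open>Covers the degenerate case: with one block gone, the survivor \<open>r\<close>
    is either left alone or reversed in place.\<close>
  have rv: "?a @ r @ ?d = ?a @ rev r @ ?d \<or> cut_paste (?a @ r @ ?d) (?a @ rev r @ ?d)" for r
  proof -
    have "block_reversal (?a @ r @ ?d) (?a @ rev r @ ?d)" if "r \<noteq> []"
      using that unfolding block_reversal_def by blast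
    then show ?thesis
      using block_reversal_imp_cut_paste by (cases "r = []") auto
  qed
  have "filter P xs = filter P ys \<or> cut_paste (filter P xs) (filter P ys)"
  proof (cases "?b = [] \<or> ?c = []")
    case True
    then show ?thesis
      using h(3,4) rv[of ?b] rv[of ?c] by (auto simp: rev_filter[symmetric])
  next
    case False
    have "cut_paste (filter P xs) (filter P ys)"
      using h(4,3) cut_pasteI[of ?b ?c ?a ?d] False by (elim disjE) (simp_all add: rev_filter)
    then show ?thesis ..
  qed
  then show ?thesis
    by (simp add: Cut_Paste)
qed

text \<open>Each step projects to one step or to none, so the projected path is no longer than the
  original. This is why the sortable sets allow at most \<open>k\<close> steps.\<close>

lemma relpowp_stuttering:
  assumes "(R ^^ j) x y" "\<And>x y. R x y \<Longrightarrow> h x = h y \<or> S (h x) (h y)"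
  shows "\<exists>i\<le>j. (S ^^ i) (h x) (h y)"
  using assms(1)
proof (induction j arbitrary: y)
  case (Suc j)
  then obtain z where z: "(R ^^ j) x z" "R z y"
    by auto
  obtain i where i: "i \<le> j" "(S ^^ i) (h x) (h z)"
    using Suc.IH[OF z(1)] by blast
  show ?case
    using assms(2)[OF z(2)]
  proof
    assume "h z = h y"
    then show ?thesis
      using i le_SucI by metis
  next
    assume "S (h z) (h y)"
    then show ?thesis
      using i by (intro exI[of _ "Suc i"]) auto
  qed
qed auto

text \<open>Describes an occurrence of a pattern by its values instead of its positions, so that it
  can be tracked while the entries are moved.\<close>

lemma filter_mem_set_subseq:
  assumes "subseq xs ys" "distinct ys"
  shows "filter (\<lambda>y. y \<in> set xs) ys = xs"
  using assms
proof (induction rule: list_emb.induct)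
  case (list_emb_Nil ys)
  then show ?case by simp
next
  case (list_emb_Cons xs ys y)
  have "set xs \<subseteq> set ys"
    using list_emb_set[OF list_emb_Cons.hyps] by auto
  then have "y \<notin> set xs"
    using list_emb_Cons.prems by auto
  then show ?case
    using list_emb_Cons by simp
next
  case (list_emb_Cons2 x y xs ys)
  then have "filter (\<lambda>z. z \<in> set (x # xs)) ys = filter (\<lambda>z. z \<in> set xs) ys"
    by (intro filter_cong) auto
  then show ?case
    using list_emb_Cons2 by simp
qed

section \<open>Closure of the sortable permutations under patterns\<close>

lemma is_perm_id_perm: "is_perm (id_perm n)"
  by (rule is_permI[of _ n]) (auto simp: id_perm_def)

lemma length_id_perm [simp]: "length (id_perm n) = n"
  by (simp add: id_perm_def)

lemma sorted_perm_eq_id_perm: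
  assumes "is_perm xs" "sorted xs"
  shows "xs = id_perm (length xs)"
proof (rule sorted_distinct_set_unique)
  show "set xs = set (id_perm (length xs))"
    using is_permD(1)[OF assms(1)] is_permD(1)[OF is_perm_id_perm[of "length xs"]] by simp
qed (use assms is_permD(2) is_perm_id_perm in \<open>auto simp: id_perm_def simp del: upt_Suc\<close>)

text \<open>Apply one and the same restriction and relabelling \<open>h\<close> to every stage of a
  sorting sequence of \<open>p\<close>. It starts at the pattern and ends at a sorted permutation,
  which is the identity.\<close>

lemma permutation_class_sortable_within: "permutation_class (sortable_within f k)"
  unfolding permutation_class_def
proof (intro conjI ballI allI impI)
  fix p
  assume "p \<in> sortable_within f k"
  then show "is_perm p"
    by (simp add: sortable_within_def)
next
  fix p s
  assume p: "p \<in> sortable_within f k" and s: "is_perm s \<and> is_pattern_of s p"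
  have perm: "is_perm p"
    using p by (simp add: sortable_within_def)
  obtain j where j: "j \<le> k" "(op_step f ^^ j) p (id_perm (length p))"
    using p by (auto simp: sortable_within_def)
  obtain xs where xs: "subseq xs p" "order_isomorphic s xs"
    using s by (auto simp: is_pattern_of_def)
  have s_eq: "s = standardize xs"
    using standardize_cong[OF xs(2)] standardize_perm s by simp
  \<comment> \<open>The rank map of the occurrence \<open>xs\<close>: it standardizes
    \<open>xs\<close> and is monotone, so it keeps the restricted identity sorted.\<close>
  define g where "g x = card {y\<in>set xs. y \<le> x}" for x
  define h where "h zs = map g (filter (\<lambda>z. z \<in> set xs) zs)" for zs
  have "h ys = h zs \<or> op_step f (h ys) (h zs)" if "op_step f ys zs" for ys zs
    using op_step_filter[OF that] op_step_map unfolding h_def by metis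
  from relpowp_stuttering[where h = h and S = "op_step f", OF j(2) this]
  obtain i where i: "i \<le> j" "(op_step f ^^ i) (h p) (h (id_perm (length p)))"
    by auto
  have hp: "h p = s"
    unfolding h_def filter_mem_set_subseq[OF xs(1) is_permD(2)[OF perm]] s_eq standardize_def g_def ..
  have "set (id_perm (length p)) = set p" "distinct (id_perm (length p))"
    using is_permD[OF perm] is_permD[OF is_perm_id_perm] by simp_all
  then have mset: "mset (id_perm (length p)) = mset p"
    using is_permD(2)[OF perm] by (simp add: set_eq_iff_mset_eq_distinct[symmetric])
  then have ms: "mset (h (id_perm (length p))) = mset s"
    unfolding hp[symmetric] h_def mset_map mset_filter by simp
  have "is_perm (h (id_perm (length p)))"
    using s mset_eq_imp_distinct_iff[OF ms] mset_eq_setD[OF ms] is_permI is_permD by metis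
  moreover have "sorted (h (id_perm (length p)))"
  proof -
    have mono: "mono g"
      unfolding g_def by (intro monoI card_mono) auto
    have "sorted (filter (\<lambda>z. z \<in> set xs) (id_perm (length p)))"
      by (intro sorted_wrt_filter) (simp add: id_perm_def del: upt_Suc)
    then show ?thesis
      unfolding h_def sorted_map by (rule sorted_wrt_mono_rel[rotated]) (rule monoD[OF mono])
  qed
  ultimately have "h (id_perm (length p)) = id_perm (length s)"
    using sorted_perm_eq_id_perm mset_eq_length[OF ms] by metis
  then show "s \<in> sortable_within f k"
    using i j(1) s hp unfolding sortable_within_def by (auto intro: order_trans)
qed

section \<open>Breakpoints\<close>

text \<open>Breakpoints without the customary sentinels at the two ends: only neighbours inside the
  list are compared.\<close>

fun breaks :: "nat list \<Rightarrow> nat" where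
  "breaks (x # y # zs) = (if adj x y then 0 else 1) + breaks (y # zs)"
| "breaks _ = 0"

lemma length_strips_le: "length (strips xs) \<le> Suc (breaks xs)"
proof (induction xs rule: strips.induct)
  case (3 x y zs)
  then show ?case
    by (cases "strips (y # zs)") auto
qed auto

lemma breaks_append:
  "breaks (xs @ ys) = breaks xs + breaks ys
     + (if xs \<noteq> [] \<and> ys \<noteq> [] \<and> \<not> adj (last xs) (hd ys) then 1 else 0)"
proof (induction xs rule: breaks.induct)
  case ("2_2" x)
  then show ?case
    by (cases ys) auto
qed auto

lemma breaks_rev [simp]: "breaks (rev xs) = breaks xs"
proof (induction xs)
  case (Cons x xs)
  then show ?case
    by (cases xs) (auto simp: breaks_append adj_commute)
qed simp

lemma breaks_append_le: "breaks (xs @ ys) \<le> breaks xs + breaks ys + 1"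
  and breaks_append_ge: "breaks xs + breaks ys \<le> breaks (xs @ ys)"
  by (auto simp: breaks_append)

text \<open>Five pieces meet at no more than four junctions, each adding at most one breakpoint, and
  the breakpoints inside the pieces balance by assumption. Empty pieces are allowed, so one bound
  serves all operations.\<close>

lemma breaks_rearrange:
  assumes "breaks b + breaks c + breaks d = breaks b' + breaks c' + breaks d'"
  shows "breaks (a @ b @ c @ d @ e) \<le> breaks (a @ b' @ c' @ d' @ e) + 4"
  using assms breaks_append_le[of a "b @ c @ d @ e"] breaks_append_le[of b "c @ d @ e"]
    breaks_append_le[of c "d @ e"] breaks_append_le[of d e]
    breaks_append_ge[of a "b' @ c' @ d' @ e"] breaks_append_ge[of b' "c' @ d' @ e"]
    breaks_append_ge[of c' "d' @ e"] breaks_append_ge[of d' e]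
  by linarith

text \<open>Each operation rearranges at most three middle pieces, some possibly reversed; reversal
  keeps the number of breakpoints because adjacency is symmetric.\<close>

lemma op_step_breaks:
  assumes "op_step f xs ys"
  shows "breaks xs \<le> breaks ys + 4"
proof (cases f)
  case Block_Reversal
  obtain a b c where "xs = a @ b @ c" "ys = a @ rev b @ c"
    using assms by (auto simp: Block_Reversal block_reversal_def)
  then show ?thesis
    using breaks_rearrange[of b "[]" "[]" "rev b" "[]" "[]" a c] by simp
next
  case Block_Transposition
  obtain a b c d where "xs = a @ b @ c @ d" "ys = a @ c @ b @ d"
    using assms by (auto simp: Block_Transposition block_transposition_iff)
  then show ?thesis
    using breaks_rearrange[of b c "[]" c b "[]" a d] by simp
next
  case Block_Interchange
  obtain a b c d e where "xs = a @ b @ c @ d @ e" "ys = a @ d @ c @ b @ e"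
    using assms by (auto simp: Block_Interchange block_interchange_def)
  then show ?thesis
    using breaks_rearrange[of b c d d c b a e] by simp
next
  case Prefix_Transposition
  obtain b u v where "xs = b @ u @ v" "ys = u @ b @ v"
    using assms by (auto simp: Prefix_Transposition prefix_transposition_def)
  then show ?thesis
    using breaks_rearrange[of b u "[]" u b "[]" "[]" v] by simp
next
  case Prefix_Reversal
  obtain b c where "xs = b @ c" "ys = rev b @ c"
    using assms by (auto simp: Prefix_Reversal prefix_reversal_def)
  then show ?thesis
    using breaks_rearrange[of b "[]" "[]" "rev b" "[]" "[]" "[]" c] by simp
next
  case Cut_Paste
  obtain a b c d where "xs = a @ b @ c @ d"
      "ys = a @ c @ b @ d \<or> ys = a @ c @ rev b @ d \<or> ys = a @ rev c @ b @ d"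
    using assms by (auto simp: Cut_Paste cut_paste_iff)
  then show ?thesis
    using breaks_rearrange[of b c "[]" c b "[]" a d] breaks_rearrange[of b c "[]" c "rev b" "[]" a d]
      breaks_rearrange[of b c "[]" "rev c" b "[]" a d]
    by (elim disjE) simp_all
qed

lemma relpowp_op_step_breaks:
  "(op_step f ^^ j) xs ys \<Longrightarrow> breaks xs \<le> breaks ys + 4 * j"
proof (induction j arbitrary: ys)
  case (Suc j)
  then obtain zs where "(op_step f ^^ j) xs zs" "op_step f zs ys"
    by auto
  then show ?case
    using Suc.IH[of zs] op_step_breaks[of f zs ys] by simp
qed simp

lemma breaks_upt: "breaks [m..<n] = 0"
  by (induction n) (auto simp: breaks_append adj_def)

text \<open>The identity has no breakpoints and going back one step adds at most four; the number of
  strips exceeds the number of breakpoints by at most one.\<close>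

lemma length_strips_sortable_within:
  assumes "p \<in> sortable_within f k"
  shows "length (strips p) \<le> Suc (4 * k)"
proof -
  obtain j where "j \<le> k" "(op_step f ^^ j) p (id_perm (length p))"
    using assms by (auto simp: sortable_within_def)
  then have "breaks p \<le> 4 * k"
    using relpowp_op_step_breaks[of j f p] by (fastforce simp: id_perm_def breaks_upt simp del: upt_Suc)
  then show ?thesis
    using length_strips_le[of p] by simp
qed

theorem theorem4p24:
  fixes f :: perm_op and k :: nat
  assumes "k \<ge> 1"
  shows "polynomial_class (sortable_within f k)"
  using permutation_class_sortable_within length_strips_sortable_within
  by (rule polynomial_class_if_bounded_strips)

end
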